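(* Let $\mathbb{A}$ be an algebra with underlying set $A$, let $k\ge 1$, and let $\theta\subseteq A^{2^k}$ be a nonempty $k$-dimensional relation. Let $C_\theta=\{\gamma_f:\gamma\in\theta,\ f\in 2^k\}$ be the set of elements of $A$ that label vertices of cubes in $\theta$. Then $\theta$ is a $k$-dimensional congruence of $\mathbb{A}$ if and only if $\theta$ is a $k$-dimensional equivalence relation on $A$ which is compatible with every $k$-ary polynomial with constants from $C_\theta$.
   Context: A natural number is identified with the set of its predecessors, $k=\{0,\dots,k-1\}$, and $2^S$ denotes the set of functions $S\to 2=\{0,1\}$. For a finite set $S$ of natural numbers, an element $\gamma\in A^{2^S}$ is called a labeled $|S|$-dimensional cube, with labels $\gamma_f$ ($f\in 2^S$); a subset of $A^{2^S}$ is an $|S|$-dimensional relation. Here $S=k$. For $i\in S$, $j\in 2$ and $\gamma\in A^{2^S}$, let $\mathrm{Faces}_i^j(\gamma)\in A^{2^{S\setminus\{i\}}}$ be the face given by $\mathrm{Faces}_i^j(\gamma)_g=\gamma_{f}$, where $f$ extends $g\in 2^{S\setminus\{i\}}$ by $f_i=j$. For $R\subseteq A^{2^S}$, let $\mathrm{Faces}_i(R)=\{\langle \mathrm{Faces}_i^0(\gamma),\mathrm{Faces}_i^1(\gamma)\rangle:\gamma\in R\}$, a binary relation on $A^{2^{S\setminus\{i\}}}$. A binary relation $R$ on a set $B$ is a quasiequivalence relation if it is quasireflexive ($\langle a,b\rangle\in R$ implies $\langle a,a\rangle,\langle b,b\rangle\in R$), symmetric and transitive. A relation $R\subseteq A^{2^S}$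 is an $|S|$-dimensional equivalence relation if $\mathrm{Faces}_i(R)$ is a quasiequivalence relation on $A^{2^{S\setminus\{i\}}}$ for each $i\in S$. It is an $|S|$-dimensional congruence of $\mathbb{A}$ if moreover it is compatible with every basic operation of $\mathbb{A}$, where compatible with an operation means closed under that operation applied coordinatewise to cubes. A $k$-ary polynomial with constants from $C\subseteq A$ is an operation $p(x_0,\dots,x_{k-1})=s(x_0,\dots,x_{k-1},c_0,\dots,c_{m-1})$, where $s$ is a term operation of $\mathbb{A}$, $m\ge 0$ and $c_0,\dots,c_{m-1}\in C$. *)

theory Defs
  imports Main "HOL-Library.FuncSet"
begin

text \<open>
  An algebra is a carrier set together with a family of finitary basic operations, indexed by
  a (possibly empty) set of symbols.  An \<open>n\<close>-ary operation on \<open>A\<close> is a function on lists, of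
  which only the values at lists of length \<open>n\<close> over \<open>A\<close> are relevant.
\<close>

definition tuples :: "nat \<Rightarrow> 'a set \<Rightarrow> 'a list set" where
  "tuples n A = {xs. length xs = n \<and> set xs \<subseteq> A}"

record ('i, 'a) ualgebra =
  universe :: "'a set"
  symbols :: "'i set"
  arity :: "'i \<Rightarrow> nat"
  basic_op :: "'i \<Rightarrow> 'a list \<Rightarrow> 'a"

definition is_algebra :: "('i, 'a) ualgebra \<Rightarrow> bool" where
  "is_algebra \<AA> \<longleftrightarrow>
     (\<forall>\<sigma>\<in>symbols \<AA>. \<forall>xs\<in>tuples (arity \<AA> \<sigma>) (universe \<AA>). basic_op \<AA> \<sigma> xs \<in> universe \<AA>)"

datatype 'i uterm = Var nat | App 'i "'i uterm list"

primrec term_eval :: "('i, 'a) ualgebra \<Rightarrow> (nat \<Rightarrow> 'a) \<Rightarrow> 'i uterm \<Rightarrow> 'a" where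
  "term_eval \<AA> x (Var v) = x v"
| "term_eval \<AA> x (App \<sigma> ts) = basic_op \<AA> \<sigma> (map (term_eval \<AA> x) ts)"

text \<open>\<open>is_term \<AA> n t\<close>: \<open>t\<close> is a well-formed term of \<open>\<AA>\<close> in the variables \<open>0, \<dots>, n - 1\<close>.\<close>

inductive is_term :: "('i, 'a) ualgebra \<Rightarrow> nat \<Rightarrow> 'i uterm \<Rightarrow> bool"
  for \<AA> :: "('i, 'a) ualgebra" and n :: nat where
  "v < n \<Longrightarrow> is_term \<AA> n (Var v)"
| "\<sigma> \<in> symbols \<AA> \<Longrightarrow> length ts = arity \<AA> \<sigma> \<Longrightarrow> (\<And>t. t \<in> set ts \<Longrightarrow> is_term \<AA> n t)
     \<Longrightarrow> is_term \<AA> n (App \<sigma> ts)"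

definition is_term_operation :: "('i, 'a) ualgebra \<Rightarrow> nat \<Rightarrow> ('a list \<Rightarrow> 'a) \<Rightarrow> bool" where
  "is_term_operation \<AA> n s \<longleftrightarrow>
     (\<exists>t. is_term \<AA> n t \<and> (\<forall>xs\<in>tuples n (universe \<AA>). s xs = term_eval \<AA> (nth xs) t))"

definition is_polynomial :: "('i, 'a) ualgebra \<Rightarrow> 'a set \<Rightarrow> nat \<Rightarrow> ('a list \<Rightarrow> 'a) \<Rightarrow> bool" where
  "is_polynomial \<AA> C k p \<longleftrightarrow>
     (\<exists>m s cs. is_term_operation \<AA> (k + m) s \<and> cs \<in> tuples m C \<and>
        (\<forall>xs\<in>tuples k (universe \<AA>). p xs = s (xs @ cs)))"

text \<open>
  The natural number \<open>n\<close> is the set \<open>{..<n}\<close>, and function spaces are sets of extensional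
  functions: \<open>two_pow S\<close> is $2^S$ and \<open>cubes S A\<close> is $A^{2^S}$.
\<close>

definition two_pow :: "nat set \<Rightarrow> (nat \<Rightarrow> nat) set" where
  "two_pow S = S \<rightarrow>\<^sub>E {..<2}"

definition cubes :: "nat set \<Rightarrow> 'a set \<Rightarrow> ((nat \<Rightarrow> nat) \<Rightarrow> 'a) set" where
  "cubes S A = two_pow S \<rightarrow>\<^sub>E A"

definition face :: "nat set \<Rightarrow> nat \<Rightarrow> nat \<Rightarrow> ((nat \<Rightarrow> nat) \<Rightarrow> 'a) \<Rightarrow> ((nat \<Rightarrow> nat) \<Rightarrow> 'a)" where
  "face S i j \<gamma> = (\<lambda>g\<in>two_pow (S - {i}). \<gamma> (g(i := j)))"

definition Faces ::
  "nat set \<Rightarrow> nat \<Rightarrow> ((nat \<Rightarrow> nat) \<Rightarrow> 'a) set \<Rightarrow> (((nat \<Rightarrow> nat) \<Rightarrow> 'a) \<times> ((nat \<Rightarrow> nat) \<Rightarrow> 'a)) set" where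
  "Faces S i R = {(face S i 0 \<gamma>, face S i 1 \<gamma>) | \<gamma>. \<gamma> \<in> R}"

definition quasireflexive :: "('b \<times> 'b) set \<Rightarrow> bool" where
  "quasireflexive R \<longleftrightarrow> (\<forall>a b. (a, b) \<in> R \<longrightarrow> (a, a) \<in> R \<and> (b, b) \<in> R)"

definition quasiequivalence_on :: "'b set \<Rightarrow> ('b \<times> 'b) set \<Rightarrow> bool" where
  "quasiequivalence_on B R \<longleftrightarrow> R \<subseteq> B \<times> B \<and> quasireflexive R \<and> sym R \<and> trans R"

definition dim_equivalence :: "nat set \<Rightarrow> 'a set \<Rightarrow> ((nat \<Rightarrow> nat) \<Rightarrow> 'a) set \<Rightarrow> bool" where
  "dim_equivalence S A R \<longleftrightarrow>
     R \<subseteq> cubes S A \<and> (\<forall>i\<in>S. quasiequivalence_on (cubes (S - {i}) A) (Faces S i R))"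

definition compatible ::
  "nat set \<Rightarrow> nat \<Rightarrow> ('a list \<Rightarrow> 'a) \<Rightarrow> ((nat \<Rightarrow> nat) \<Rightarrow> 'a) set \<Rightarrow> bool" where
  "compatible S n h R \<longleftrightarrow>
     (\<forall>\<Gamma>\<in>tuples n R. (\<lambda>f\<in>two_pow S. h (map (\<lambda>\<gamma>. \<gamma> f) \<Gamma>)) \<in> R)"

definition dim_congruence ::
  "nat set \<Rightarrow> ('i, 'a) ualgebra \<Rightarrow> ((nat \<Rightarrow> nat) \<Rightarrow> 'a) set \<Rightarrow> bool" where
  "dim_congruence S \<AA> R \<longleftrightarrow>
     dim_equivalence S (universe \<AA>) R \<and>
     (\<forall>\<sigma>\<in>symbols \<AA>. compatible S (arity \<AA> \<sigma>) (basic_op \<AA> \<sigma>) R)"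

definition labels :: "nat set \<Rightarrow> ((nat \<Rightarrow> nat) \<Rightarrow> 'a) set \<Rightarrow> 'a set" where
  "labels S R = {\<gamma> f | \<gamma> f. \<gamma> \<in> R \<and> f \<in> two_pow S}"

end

theory Submission
  imports Defs
begin

text \<open>
  The interesting direction generalises the classical fact that an equivalence relation which is
  preserved by unary polynomials is a congruence, where one passes from
  \<open>h(a\<^sub>1, \<dots>, a\<^sub>n)\<close> to \<open>h(b\<^sub>1, \<dots>, b\<^sub>n)\<close> by changing one argument at a time. In
  dimension \<open>k\<close> the arguments are cubes \<open>\<gamma>\<^sub>0, \<dots>, \<gamma>\<^sub>n\<^sub>-\<^sub>1\<close> of \<open>\<theta>\<close>, and arguments are changed one at
  a time independently in each of the \<open>k\<close> directions. This subdivides the cube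
  \<open>h(\<gamma>\<^sub>0, \<dots>, \<gamma>\<^sub>n\<^sub>-\<^sub>1)\<close> into a grid on \<open>{0, \<dots>, n}\<^sup>k\<close>: at the grid point \<open>p\<close>, the \<open>l\<close>-th argument
  is the vertex of \<open>\<gamma>\<^sub>l\<close> whose \<open>i\<close>-th coordinate is \<open>1\<close> exactly if \<open>l < p\<^sub>i\<close>.

  Inside one unit cell of the grid, moving in direction \<open>i\<close> changes a single argument, so at most
  \<open>k\<close> of the \<open>n\<close> arguments vary at all. The others are labels of cubes of \<open>\<theta>\<close>, and each of the
  varying ones runs through a cube obtained from some \<open>\<gamma>\<^sub>l\<close> by freezing coordinates, which
  belongs to \<open>\<theta>\<close> by quasireflexivity (\<open>freeze_coordinates\<close>). Hence the cell is the value of a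
  \<open>k\<close>-ary polynomial at \<open>k\<close> cubes of \<open>\<theta>\<close> and lies in \<open>\<theta>\<close> (\<open>unit_cell_in_relation\<close>). Transitivity
  glues cells along common faces (\<open>glue_grid\<close>), and the whole grid is the cube
  \<open>h(\<gamma>\<^sub>0, \<dots>, \<gamma>\<^sub>n\<^sub>-\<^sub>1)\<close>.

  Conversely, freezing all coordinates puts every constant cube with label in \<open>C\<^sub>\<theta>\<close> into \<open>\<theta>\<close>
  (\<open>constant_cube\<close>), so that a polynomial of cubes is a term of cubes, and \<open>\<theta>\<close> is closed under
  terms.
\<close>

section \<open>Cubes and their faces\<close>

lemma restrict_mem_cong:
  "(\<lambda>x\<in>T. u x) \<in> R \<Longrightarrow> (\<And>x. x \<in> T \<Longrightarrow> u x = v x) \<Longrightarrow> (\<lambda>x\<in>T. v x) \<in> R"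
  by (metis restrict_ext)

lemma two_pow_upd: "f \<in> two_pow S \<Longrightarrow> i \<in> S \<Longrightarrow> j < 2 \<Longrightarrow> f(i := j) \<in> two_pow S"
  unfolding two_pow_def by (auto simp: PiE_iff extensional_def)

lemma two_pow_less: "f \<in> two_pow S \<Longrightarrow> i \<in> S \<Longrightarrow> f i < 2"
  unfolding two_pow_def by auto

lemma two_pow_restrict: "f \<in> two_pow S \<Longrightarrow> restrict f (S - {i}) \<in> two_pow (S - {i})"
  unfolding two_pow_def by auto

lemma two_pow_extend: "g \<in> two_pow (S - {i}) \<Longrightarrow> i \<in> S \<Longrightarrow> j < 2 \<Longrightarrow> g(i := j) \<in> two_pow S"
  unfolding two_pow_def by (auto simp: PiE_iff extensional_def)

lemma restrict_upd_two_pow: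
  "f \<in> two_pow S \<Longrightarrow> i \<in> S \<Longrightarrow> (restrict f (S - {i}))(i := j) = f(i := j)"
  unfolding two_pow_def by (auto simp: PiE_iff extensional_def fun_eq_iff)

lemma face_at:
  "f \<in> two_pow S \<Longrightarrow> i \<in> S \<Longrightarrow> face S i j \<gamma> (restrict f (S - {i})) = \<gamma> (f(i := j))"
  using restrict_upd_two_pow[of f S i j] by (simp add: face_def two_pow_restrict del: restrict_upd)

lemma cube_eqI_faces:
  assumes "i \<in> S" "\<gamma> \<in> extensional (two_pow S)" "\<delta> \<in> extensional (two_pow S)"
    and "face S i 0 \<gamma> = face S i 0 \<delta>" "face S i 1 \<gamma> = face S i 1 \<delta>"
  shows "\<gamma> = \<delta>"
proof (rule extensionalityI[OF assms(2,3)])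
  fix f assume f: "f \<in> two_pow S"
  have "f i = 0 \<or> f i = 1" using two_pow_less[OF f assms(1)] by auto
  then have "face S i (f i) \<gamma> = face S i (f i) \<delta>" using assms(4,5) by auto
  then have "\<gamma> (f(i := f i)) = \<delta> (f(i := f i))" using face_at[OF f assms(1)] by metis
  then show "\<gamma> f = \<delta> f" by simp
qed

lemma dim_equivalence_extensional:
  "dim_equivalence S A R \<Longrightarrow> \<gamma> \<in> R \<Longrightarrow> \<gamma> \<in> extensional (two_pow S)"
  unfolding dim_equivalence_def cubes_def by (blast dest: PiE_iff[THEN iffD1])

section \<open>Freezing coordinates\<close>

lemma freeze_coordinate:
  assumes R: "dim_equivalence S A R" and \<gamma>: "\<gamma> \<in> R" and i: "i \<in> S" and j: "j < 2"
  shows "(\<lambda>f\<in>two_pow S. \<gamma> (f(i := j))) \<in> R"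
proof -
  have "quasireflexive (Faces S i R)"
    using R i by (auto simp: dim_equivalence_def quasiequivalence_on_def)
  moreover have "(face S i 0 \<gamma>, face S i 1 \<gamma>) \<in> Faces S i R"
    using \<gamma> by (auto simp: Faces_def)
  ultimately have "(face S i j \<gamma>, face S i j \<gamma>) \<in> Faces S i R"
    using j unfolding quasireflexive_def by (cases "j = 0") (auto simp: less_2_cases_iff)
  then obtain \<delta> where \<delta>: "\<delta> \<in> R" "face S i 0 \<delta> = face S i j \<gamma>" "face S i 1 \<delta> = face S i j \<gamma>"
    unfolding Faces_def by auto
  have "face S i j' (\<lambda>f\<in>two_pow S. \<gamma> (f(i := j))) = face S i j \<gamma>" if "j' < 2" for j'
    using i that by (auto simp: face_def fun_eq_iff two_pow_extend)
  then have "\<delta> = (\<lambda>f\<in>two_pow S. \<gamma> (f(i := j)))"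
    using \<delta> dim_equivalence_extensional[OF R \<delta>(1)]
    by - (rule cube_eqI_faces[OF i], simp_all del: restrict_apply)
  then show ?thesis using \<delta>(1) by simp
qed

text \<open>
  Quasireflexivity in direction \<open>i\<close> says that either \<open>i\<close>-face of a cube, doubled in direction \<open>i\<close>,
  is again in the relation; doing this for all \<open>i \<in> F\<close> freezes the coordinates in \<open>F\<close>.
\<close>

lemma freeze_coordinates:
  assumes R: "dim_equivalence S A R" and \<gamma>: "\<gamma> \<in> R"
    and "finite F" "F \<subseteq> S" "\<And>i. i \<in> F \<Longrightarrow> e i < 2"
  shows "(\<lambda>f\<in>two_pow S. \<gamma> (\<lambda>i. if i \<in> F then e i else f i)) \<in> R"
  using assms(3-5)
proof (induction F)
  case empty
  have "(\<lambda>f\<in>two_pow S. \<gamma> f) = \<gamma>"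
    using dim_equivalence_extensional[OF R \<gamma>] by (rule extensional_restrict)
  then show ?case using \<gamma> by simp
next
  case (insert m F)
  let ?\<delta> = "\<lambda>f\<in>two_pow S. \<gamma> (\<lambda>i. if i \<in> F then e i else f i)"
  have m: "m \<in> S" "e m < 2" using insert.prems by auto
  have "(\<lambda>f\<in>two_pow S. ?\<delta> (f(m := e m))) \<in> R"
    by (rule freeze_coordinate[OF R]) (use insert m in auto)
  moreover have "?\<delta> (f(m := e m)) = \<gamma> (\<lambda>i. if i \<in> insert m F then e i else f i)"
    if f: "f \<in> two_pow S" for f
  proof -
    have "(\<lambda>i. if i \<in> F then e i else (f(m := e m)) i) = (\<lambda>i. if i \<in> insert m F then e i else f i)"
      using insert.hyps by (auto simp: fun_eq_iff)
    then show ?thesis using two_pow_upd[OF f m] by simp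
  qed
  ultimately show ?case by (rule restrict_mem_cong)
qed

lemma constant_cube:
  assumes R: "dim_equivalence S A R" and "finite S" and c: "c \<in> labels S R"
  shows "(\<lambda>f\<in>two_pow S. c) \<in> R"
proof -
  obtain \<gamma> g where g: "\<gamma> \<in> R" "g \<in> two_pow S" "c = \<gamma> g"
    using c by (auto simp: labels_def)
  have "(\<lambda>i. if i \<in> S then g i else f i) = g" if "f \<in> two_pow S" for f
    using that g(2) by (auto simp: two_pow_def PiE_iff extensional_def fun_eq_iff)
  moreover have "(\<lambda>f\<in>two_pow S. \<gamma> (\<lambda>i. if i \<in> S then g i else f i)) \<in> R"
    using g two_pow_less[OF g(2)] assms(2) by (intro freeze_coordinates[OF R]) auto
  ultimately show ?thesis using g(3) by (simp cong: restrict_cong)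
qed

section \<open>Congruences are compatible with polynomials\<close>

lemma term_eval_cong:
  "is_term \<AA> n t \<Longrightarrow> (\<And>v. v < n \<Longrightarrow> x v = y v) \<Longrightarrow> term_eval \<AA> x t = term_eval \<AA> y t"
proof (induction rule: is_term.induct)
  case (2 \<sigma> ts)
  then have "map (term_eval \<AA> x) ts = map (term_eval \<AA> y) ts" by auto
  then show ?case by (simp only: term_eval.simps)
qed auto

lemma dim_congruence_closed_under_terms:
  assumes "dim_congruence S \<AA> R" and "is_term \<AA> n t" and "\<And>v. v < n \<Longrightarrow> \<Psi> v \<in> R"
  shows "(\<lambda>f\<in>two_pow S. term_eval \<AA> (\<lambda>v. \<Psi> v f) t) \<in> R"
  using assms(2)
proof (induction rule: is_term.induct)
  case (1 v)
  then have "\<Psi> v \<in> extensional (two_pow S)" "\<Psi> v \<in> R"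
    using assms dim_equivalence_extensional[of S "universe \<AA>" R]
    by (auto simp: dim_congruence_def)
  then show ?case by (simp add: extensional_restrict)
next
  case (2 \<sigma> ts)
  let ?\<Gamma> = "map (\<lambda>t. \<lambda>f\<in>two_pow S. term_eval \<AA> (\<lambda>v. \<Psi> v f) t) ts"
  have "?\<Gamma> \<in> tuples (arity \<AA> \<sigma>) R" using 2 by (auto simp: tuples_def simp del: restrict_apply)
  moreover have "compatible S (arity \<AA> \<sigma>) (basic_op \<AA> \<sigma>) R"
    using assms(1) 2 by (auto simp: dim_congruence_def)
  ultimately have "(\<lambda>f\<in>two_pow S. basic_op \<AA> \<sigma> (map (\<lambda>\<gamma>. \<gamma> f) ?\<Gamma>)) \<in> R"
    by (auto simp: compatible_def)
  then show ?case by (rule restrict_mem_cong) (simp add: comp_def)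
qed

lemma dim_congruence_compatible_polynomial:
  assumes cong: "dim_congruence S \<AA> R" and "finite S" and p: "is_polynomial \<AA> (labels S R) n p"
  shows "compatible S n p R"
  unfolding compatible_def
proof
  fix \<Gamma> assume \<Gamma>: "\<Gamma> \<in> tuples n R"
  have R: "dim_equivalence S (universe \<AA>) R" using cong by (simp add: dim_congruence_def)
  then have sub: "R \<subseteq> cubes S (universe \<AA>)" by (simp add: dim_equivalence_def)
  obtain m s cs t where cs: "cs \<in> tuples m (labels S R)" and t: "is_term \<AA> (n + m) t"
    and s: "\<And>xs. xs \<in> tuples (n + m) (universe \<AA>) \<Longrightarrow> s xs = term_eval \<AA> (nth xs) t"
    and ps: "\<And>xs. xs \<in> tuples n (universe \<AA>) \<Longrightarrow> p xs = s (xs @ cs)"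
    using p unfolding is_polynomial_def is_term_operation_def by blast
  have labels_sub: "labels S R \<subseteq> universe \<AA>" using sub by (auto simp: labels_def cubes_def)
  let ?\<Psi> = "\<Gamma> @ map (\<lambda>c. \<lambda>f\<in>two_pow S. c) cs"
  have "set ?\<Psi> \<subseteq> R" "length ?\<Psi> = n + m"
    using \<Gamma> cs constant_cube[OF R \<open>finite S\<close>] by (auto simp: tuples_def)
  then have "(\<lambda>f\<in>two_pow S. term_eval \<AA> (\<lambda>v. (?\<Psi> ! v) f) t) \<in> R"
    by (intro dim_congruence_closed_under_terms[OF cong t]) (metis nth_mem subsetD)
  moreover have "term_eval \<AA> (\<lambda>v. (?\<Psi> ! v) f) t = p (map (\<lambda>\<gamma>. \<gamma> f) \<Gamma>)" if f: "f \<in> two_pow S" for f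
  proof -
    let ?xs = "map (\<lambda>\<gamma>. \<gamma> f) \<Gamma>"
    have xs: "?xs \<in> tuples n (universe \<AA>)"
      using \<Gamma> sub f by (auto simp: tuples_def cubes_def)
    then have "?xs @ cs \<in> tuples (n + m) (universe \<AA>)"
      using cs labels_sub by (auto simp: tuples_def)
    then have "p ?xs = term_eval \<AA> (nth (?xs @ cs)) t" using ps[OF xs] s by simp
    also have "\<dots> = term_eval \<AA> (\<lambda>v. (?\<Psi> ! v) f) t"
      using \<Gamma> cs f by (intro term_eval_cong[OF t]) (auto simp: tuples_def nth_append)
    finally show ?thesis by (rule sym)
  qed
  ultimately show "(\<lambda>f\<in>two_pow S. p (map (\<lambda>\<gamma>. \<gamma> f) \<Gamma>)) \<in> R"
    by (rule restrict_mem_cong)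
qed

section \<open>Gluing the cells of a grid\<close>

definition box_vertex :: "nat set \<Rightarrow> (nat \<Rightarrow> nat) \<Rightarrow> (nat \<Rightarrow> nat) \<Rightarrow> (nat \<Rightarrow> nat) \<Rightarrow> nat \<Rightarrow> nat" where
  "box_vertex S a b f = (\<lambda>i\<in>S. if f i = 0 then a i else b i)"

definition box_cube ::
  "nat set \<Rightarrow> ((nat \<Rightarrow> nat) \<Rightarrow> 'a) \<Rightarrow> (nat \<Rightarrow> nat) \<Rightarrow> (nat \<Rightarrow> nat) \<Rightarrow> (nat \<Rightarrow> nat) \<Rightarrow> 'a" where
  "box_cube S G a b = (\<lambda>f\<in>two_pow S. G (box_vertex S a b f))"

lemma face_box_cube:
  assumes "i \<in> S" "j < 2"
  shows "face S i j (box_cube S G a b) =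
    (\<lambda>g\<in>two_pow (S - {i}). G (box_vertex S a b (g(i := j))))"
  using assms by (auto simp: face_def box_cube_def fun_eq_iff two_pow_extend)

text \<open>
  Cutting the box from \<open>a\<close> to \<open>b\<close> by the hyperplane at height \<open>c\<close> in direction \<open>i\<close> leaves two boxes
  with a common face, and transitivity in direction \<open>i\<close> composes the corresponding cubes.
\<close>

lemma glue_boxes:
  assumes R: "dim_equivalence S A R" and i: "i \<in> S"
    and lower: "box_cube S G a (b(i := c)) \<in> R" and upper: "box_cube S G (a(i := c)) b \<in> R"
  shows "box_cube S G a b \<in> R"
proof -
  let ?L = "box_cube S G a (b(i := c))" and ?U = "box_cube S G (a(i := c)) b"
  have "trans (Faces S i R)"
    using R i by (auto simp: dim_equivalence_def quasiequivalence_on_def)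
  moreover have "(face S i 0 ?L, face S i 1 ?L) \<in> Faces S i R"
    "(face S i 0 ?U, face S i 1 ?U) \<in> Faces S i R"
    using lower upper by (auto simp: Faces_def)
  moreover have "box_vertex S a (b(i := c)) (g(i := 1)) = box_vertex S (a(i := c)) b (g(i := 0))"
    for g by (auto simp: box_vertex_def fun_eq_iff)
  then have "face S i 1 ?L = face S i 0 ?U"
    using i by (simp add: face_box_cube)
  ultimately have "(face S i 0 ?L, face S i 1 ?U) \<in> Faces S i R"
    by (metis transD)
  then obtain \<delta> where \<delta>: "\<delta> \<in> R" "face S i 0 \<delta> = face S i 0 ?L" "face S i 1 \<delta> = face S i 1 ?U"
    unfolding Faces_def by auto
  have "box_vertex S a (b(i := c)) (g(i := 0)) = box_vertex S a b (g(i := 0))"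
    "box_vertex S (a(i := c)) b (g(i := 1)) = box_vertex S a b (g(i := 1))" for g
    by (auto simp: box_vertex_def fun_eq_iff)
  then have "face S i 0 ?L = face S i 0 (box_cube S G a b)"
    "face S i 1 ?U = face S i 1 (box_cube S G a b)"
    using i by (simp_all add: face_box_cube)
  then have "\<delta> = box_cube S G a b"
    using \<delta> dim_equivalence_extensional[OF R \<delta>(1)]
    by - (rule cube_eqI_faces[OF i], simp_all add: box_cube_def)
  then show ?thesis using \<delta>(1) by simp
qed

text \<open>
  Repeated cutting leaves only cells with edges of length at most \<open>1\<close>. Length \<open>0\<close> occurs when
  the box itself is degenerate; for a nullary operation the whole grid is a single point.
\<close>

lemma glue_grid:
  assumes R: "dim_equivalence S A R" and "finite S"
    and cell: "\<And>a b. (\<And>i. i \<in> S \<Longrightarrow> a i \<le> b i \<and> b i \<le> Suc (a i)) \<Longrightarrow> box_cube S G a b \<in> R"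
    and "\<And>i. i \<in> S \<Longrightarrow> a i \<le> b i"
  shows "box_cube S G a b \<in> R"
  using assms(4)
proof (induction "\<Sum>i\<in>S. b i - a i" arbitrary: a b rule: less_induct)
  case less
  show ?case
  proof (cases "\<forall>i\<in>S. b i \<le> Suc (a i)")
    case True
    then show ?thesis using less.prems by (intro cell) auto
  next
    case False
    then obtain i where i: "i \<in> S" "Suc (a i) < b i" by force
    have "(\<Sum>l\<in>S. (b(i := Suc (a i))) l - a l) < (\<Sum>l\<in>S. b l - a l)"
      "(\<Sum>l\<in>S. b l - (a(i := Suc (a i))) l) < (\<Sum>l\<in>S. b l - a l)"
      using i \<open>finite S\<close> by (auto intro!: sum_strict_mono_ex1 bexI[of _ i])
    then have "box_cube S G a (b(i := Suc (a i))) \<in> R" "box_cube S G (a(i := Suc (a i))) b \<in> R"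
      using i less.prems by (auto intro!: less.hyps)
    then show ?thesis by (rule glue_boxes[OF R i(1)])
  qed
qed

section \<open>Compatibility with polynomials suffices\<close>

definition staircase_vertex :: "nat set \<Rightarrow> (nat \<Rightarrow> nat) \<Rightarrow> nat \<Rightarrow> nat \<Rightarrow> nat" where
  "staircase_vertex S p l = (\<lambda>i\<in>S. if l < p i then 1 else 0)"

text \<open>
  In the cell from \<open>a\<close> to \<open>b\<close>, direction \<open>i\<close> moves only the argument with index \<open>a i\<close> (if it moves
  anything). So one variable for each direction suffices: variable \<open>i\<close> is fed with the cube that
  argument \<open>a i\<close> runs through, and each moving argument picks one of the directions moving it.
\<close>

lemma unit_cell_in_relation:
  fixes k :: nat
  defines "S \<equiv> {..<k}"
  assumes R: "dim_equivalence S (universe \<AA>) R"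
    and poly: "\<And>p. is_polynomial \<AA> (labels S R) k p \<Longrightarrow> compatible S k p R"
    and \<sigma>: "\<sigma> \<in> symbols \<AA>" and \<gamma>: "\<And>l. \<gamma> l \<in> R"
    and cell: "\<And>i. i \<in> S \<Longrightarrow> a i \<le> b i \<and> b i \<le> Suc (a i)"
  defines "G \<equiv> \<lambda>p. basic_op \<AA> \<sigma> (map (\<lambda>l. \<gamma> l (staircase_vertex S p l)) [0..<arity \<AA> \<sigma>])"
  shows "box_cube S G a b \<in> R"
proof -
  define n where "n = arity \<AA> \<sigma>"
  define moves where "moves l = {i \<in> S. a i = l \<and> b i = Suc l}" for l
  define \<Delta> where "\<Delta> l = (\<lambda>f\<in>two_pow S.
    \<gamma> l (\<lambda>i. if i \<in> S - moves l then (if l < a i then 1 else 0) else f i))" for l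
  have \<Delta>: "\<Delta> l \<in> R" for l
    unfolding \<Delta>_def
    by (rule freeze_coordinates[OF R \<gamma>]) (auto simp: S_def)
  have argument: "\<gamma> l (staircase_vertex S (box_vertex S a b f) l) = \<Delta> l f" if f: "f \<in> two_pow S" for f l
  proof -
    have "staircase_vertex S (box_vertex S a b f) l i =
      (if i \<in> S - moves l then (if l < a i then 1 else 0) else f i)" for i
    proof (cases "i \<in> S")
      case True
      then show ?thesis using cell[OF True] two_pow_less[OF f True]
        by (auto simp: staircase_vertex_def box_vertex_def moves_def less_2_cases_iff)
    next
      case False
      then show ?thesis using f by (auto simp: staircase_vertex_def two_pow_def PiE_iff extensional_def)
    qed
    then have "staircase_vertex S (box_vertex S a b f) l =
      (\<lambda>i. if i \<in> S - moves l then (if l < a i then 1 else 0) else f i)" by (rule ext)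
    then show ?thesis using f by (simp add: \<Delta>_def)
  qed

  define z where "z = (\<lambda>i\<in>S. 0 :: nat)"
  have z: "z \<in> two_pow S" by (auto simp: z_def two_pow_def)
  have unmoved: "\<Delta> l f = \<Delta> l z" if "f \<in> two_pow S" "moves l = {}" for l f
  proof -
    have "(\<lambda>i. if i \<in> S then (if l < a i then 1 else 0) else f i) =
      (\<lambda>i. if i \<in> S then (if l < a i then 1 else 0) else z i)"
      using that(1) z by (auto simp: two_pow_def PiE_iff extensional_def fun_eq_iff)
    then show ?thesis using that z by (simp add: \<Delta>_def)
  qed

  define dir where "dir l = (SOME i. i \<in> moves l)" for l
  have dir: "dir l < k" "a (dir l) = l" if "moves l \<noteq> {}" for l
  proof -
    have "dir l \<in> moves l" unfolding dir_def using that by (simp add: some_in_eq)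
    then show "dir l < k" "a (dir l) = l" by (auto simp: moves_def S_def)
  qed
  \<comment> \<open>The variables from \<open>k\<close> on are replaced by the constants \<open>cs\<close>; variable \<open>k + l\<close> serves
    argument \<open>l\<close> in case it does not move.\<close>
  define cs where "cs = map (\<lambda>l. \<Delta> l z) [0..<n]"
  define t where
    "t = App \<sigma> (map (\<lambda>l. Var (if moves l \<noteq> {} then dir l else k + l)) [0..<n])"
  define p where "p xs = term_eval \<AA> (nth (xs @ cs)) t" for xs
  have "is_term \<AA> (k + n) t"
    using \<sigma> dir by (auto simp: t_def n_def trans_less_add1 intro!: is_term.intros)
  moreover have "cs \<in> tuples n (labels S R)"
    using \<Delta> z by (auto simp: cs_def tuples_def labels_def)
  ultimately have "is_polynomial \<AA> (labels S R) k p"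
    unfolding is_polynomial_def is_term_operation_def p_def
    by (intro exI[of _ n] exI[of _ "\<lambda>ys. term_eval \<AA> (nth ys) t"] exI[of _ cs]) blast
  then have "compatible S k p R" by (rule poly)
  moreover have "map (\<lambda>i. \<Delta> (a i)) [0..<k] \<in> tuples k R"
    using \<Delta> by (auto simp: tuples_def)
  ultimately have "(\<lambda>f\<in>two_pow S. p (map (\<lambda>\<gamma>. \<gamma> f) (map (\<lambda>i. \<Delta> (a i)) [0..<k]))) \<in> R"
    by (auto simp: compatible_def)
  moreover have "p (map (\<lambda>\<gamma>. \<gamma> f) (map (\<lambda>i. \<Delta> (a i)) [0..<k])) = G (box_vertex S a b f)"
    if f: "f \<in> two_pow S" for f
  proof -
    have "(map (\<lambda>i. \<Delta> (a i) f) [0..<k] @ cs) ! (if moves l \<noteq> {} then dir l else k + l) = \<Delta> l f"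
      if "l < n" for l
      using that dir[of l] unmoved[OF f, of l] by (auto simp: nth_append cs_def)
    then show ?thesis
      unfolding G_def p_def t_def n_def[symmetric] argument[OF f]
      by (auto simp: comp_def intro!: arg_cong[where f = "basic_op \<AA> \<sigma>"])
  qed
  ultimately show ?thesis unfolding box_cube_def by (rule restrict_mem_cong)
qed

lemma compatible_basic_op_if_polynomials:
  fixes k :: nat
  assumes R: "dim_equivalence {..<k} (universe \<AA>) R" and "R \<noteq> {}"
    and poly: "\<And>p. is_polynomial \<AA> (labels {..<k} R) k p \<Longrightarrow> compatible {..<k} k p R"
    and \<sigma>: "\<sigma> \<in> symbols \<AA>"
  shows "compatible {..<k} (arity \<AA> \<sigma>) (basic_op \<AA> \<sigma>) R"
  unfolding compatible_def
proof
  fix \<Gamma> assume \<Gamma>: "\<Gamma> \<in> tuples (arity \<AA> \<sigma>) R"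
  let ?S = "{..<k}" and ?n = "arity \<AA> \<sigma>"
  obtain \<gamma>0 where \<gamma>0: "\<gamma>0 \<in> R" using \<open>R \<noteq> {}\<close> by auto
  \<comment> \<open>Cells anywhere in the infinite grid are considered, so the finite sequence of arguments is
    continued by an arbitrary cube.\<close>
  define \<gamma> where "\<gamma> l = (if l < ?n then \<Gamma> ! l else \<gamma>0)" for l
  have \<gamma>: "\<gamma> l \<in> R" for l using \<Gamma> \<gamma>0 by (auto simp: \<gamma>_def tuples_def)
  define G where "G p = basic_op \<AA> \<sigma> (map (\<lambda>l. \<gamma> l (staircase_vertex ?S p l)) [0..<?n])" for p
  have "box_cube ?S G (\<lambda>_. 0) (\<lambda>_. ?n) \<in> R"
  proof (rule glue_grid[OF R])
    show "box_cube ?S G a b \<in> R" if "\<And>i. i \<in> ?S \<Longrightarrow> a i \<le> b i \<and> b i \<le> Suc (a i)" for a b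
      unfolding G_def by (rule unit_cell_in_relation[OF R poly \<sigma> \<gamma> that])
  qed auto
  moreover have "G (box_vertex ?S (\<lambda>_. 0) (\<lambda>_. ?n) f) = basic_op \<AA> \<sigma> (map (\<lambda>\<gamma>. \<gamma> f) \<Gamma>)"
    if f: "f \<in> two_pow ?S" for f
  proof -
    have "staircase_vertex ?S (box_vertex ?S (\<lambda>_. 0) (\<lambda>_. ?n) f) l i = f i" if "l < ?n" for l i
    proof (cases "i \<in> ?S")
      case True
      then show ?thesis using that two_pow_less[OF f True]
        by (auto simp: staircase_vertex_def box_vertex_def less_2_cases_iff)
    next
      case False
      then show ?thesis using f
        by (auto simp: staircase_vertex_def two_pow_def PiE_iff extensional_def)
    qed
    then have "staircase_vertex ?S (box_vertex ?S (\<lambda>_. 0) (\<lambda>_. ?n) f) l = f" if "l < ?n" for l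
      using that by (simp add: fun_eq_iff)
    then have "map (\<lambda>l. \<gamma> l (staircase_vertex ?S (box_vertex ?S (\<lambda>_. 0) (\<lambda>_. ?n) f) l)) [0..<?n] =
      map (\<lambda>\<gamma>. \<gamma> f) \<Gamma>"
      using \<Gamma> by (intro nth_equalityI) (auto simp: \<gamma>_def tuples_def)
    then show ?thesis by (simp only: G_def)
  qed
  ultimately show "(\<lambda>f\<in>two_pow ?S. basic_op \<AA> \<sigma> (map (\<lambda>\<gamma>. \<gamma> f) \<Gamma>)) \<in> R"
    unfolding box_cube_def by (rule restrict_mem_cong)
qed

theorem theorem3p5:
  fixes \<AA> :: "('i, 'a) ualgebra" and k :: nat and \<theta> :: "((nat \<Rightarrow> nat) \<Rightarrow> 'a) set"
  assumes "is_algebra \<AA>"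
    and "k \<ge> 1"
    and "\<theta> \<subseteq> cubes {..<k} (universe \<AA>)"
    and "\<theta> \<noteq> {}"
  shows "dim_congruence {..<k} \<AA> \<theta> \<longleftrightarrow>
    dim_equivalence {..<k} (universe \<AA>) \<theta> \<and>
    (\<forall>p. is_polynomial \<AA> (labels {..<k} \<theta>) k p \<longrightarrow> compatible {..<k} k p \<theta>)"
  using dim_congruence_compatible_polynomial[of "{..<k}" \<AA> \<theta> k]
    compatible_basic_op_if_polynomials[of k \<AA> \<theta>] assms(4)
  by (auto simp: dim_congruence_def)

end
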